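(* Let $\mathbf{u}$ be an infinite word over a finite alphabet $\mathcal{A}$ with $\#\mathcal{A}=k$, whose language $\mathcal{L}(\mathbf{u})$ is closed under reversal, and assume that the factor complexity of $\mathbf{u}$ satisfies $\mathcal{C}(n)=(k-1)n+1$ for all $n\in\mathbb{N}$. Then every palindrome in $\mathcal{L}(\mathbf{u})$ has a unique palindromic extension in $\mathbf{u}$ if and only if all bispecial factors of $\mathbf{u}$ are ordinary.
   Context: An infinite word over a finite alphabet $\mathcal{A}$ is a one-sided infinite sequence $\mathbf{u}=u_0u_1u_2\ldots$ of letters of $\mathcal{A}$ in which every letter of $\mathcal{A}$ occurs. Its language $\mathcal{L}(\mathbf{u})$ is the set of all its finite factors (contiguous subwords), including the empty word; $\mathcal{C}(n)$ is the number of distinct factors of length $n$; $\mathbb{N}$ includes $0$. The reversal of $w=w_0\cdots w_{n-1}$ is $\overline{w}=w_{n-1}\cdots w_0$; $w$ is a palindrome if $w=\overline{w}$ (the empty word is a palindrome). $\mathcal{L}(\mathbf{u})$ is closed under reversal if $w\in\mathcal{L}(\mathbf{u})$ implies $\overline{w}\in\mathcal{L}(\mathbf{u})$. For a palindrome $w\in\mathcal{L}(\mathbf{u})$, a palindromic extension of $w$ is a word $awa\in\mathcal{L}(\mathbf{u})$ with $a\in\mathcal{A}$. For $w\in\mathcal{L}(\mathbf{u})$: $\mathrm{Lext}(w)=\{a\in\mathcal{A}: aw\in\mathcal{L}(\mathbf{u})\}$, $\mathrm{Rext}(w)=\{a\in\mathcal{A}: wa\in\mathcal{L}(\mathbf{u})\}$,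 $\mathrm{Bext}(w)=\{awb\in\mathcal{L}(\mathbf{u}): a,b\in\mathcal{A}\}$. A factor $w$ is bispecial if $\#\mathrm{Lext}(w)\ge 2$ and $\#\mathrm{Rext}(w)\ge 2$. The bilateral order of $w$ is $\mathrm{b}(w)=\#\mathrm{Bext}(w)-\#\mathrm{Rext}(w)-\#\mathrm{Lext}(w)+1$; a bispecial factor $w$ is ordinary if $\mathrm{b}(w)=0$. *)

theory Defs
  imports "HOL-Library.Omega_Words_Fun"
begin

definition language :: "'a word \<Rightarrow> 'a list set" where
  "language u = {subsequence u i j | i j. i \<le> j}"

definition complexity :: "'a word \<Rightarrow> nat \<Rightarrow> nat" where
  "complexity u n = card {w \<in> language u. length w = n}"

definition palindrome :: "'a list \<Rightarrow> bool" where
  "palindrome w \<longleftrightarrow> w = rev w"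

definition closed_under_reversal :: "'a word \<Rightarrow> bool" where
  "closed_under_reversal u \<longleftrightarrow> (\<forall>w \<in> language u. rev w \<in> language u)"

definition palindromic_extension :: "'a set \<Rightarrow> 'a word \<Rightarrow> 'a list \<Rightarrow> 'a list \<Rightarrow> bool" where
  "palindromic_extension A u w v \<longleftrightarrow> v \<in> language u \<and> (\<exists>a \<in> A. v = [a] @ w @ [a])"

definition Lext :: "'a set \<Rightarrow> 'a word \<Rightarrow> 'a list \<Rightarrow> 'a set" where
  "Lext A u w = {a \<in> A. [a] @ w \<in> language u}"

definition Rext :: "'a set \<Rightarrow> 'a word \<Rightarrow> 'a list \<Rightarrow> 'a set" where
  "Rext A u w = {a \<in> A. w @ [a] \<in> language u}"

definition Bext :: "'a set \<Rightarrow> 'a word \<Rightarrow> 'a list \<Rightarrow> 'a list set" where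
  "Bext A u w = {[a] @ w @ [b] | a b. a \<in> A \<and> b \<in> A \<and> [a] @ w @ [b] \<in> language u}"

definition bispecial :: "'a set \<Rightarrow> 'a word \<Rightarrow> 'a list \<Rightarrow> bool" where
  "bispecial A u w \<longleftrightarrow>
     w \<in> language u \<and> card (Lext A u w) \<ge> 2 \<and> card (Rext A u w) \<ge> 2"

definition bilateral_order :: "'a set \<Rightarrow> 'a word \<Rightarrow> 'a list \<Rightarrow> int" where
  "bilateral_order A u w =
     int (card (Bext A u w)) - int (card (Rext A u w)) - int (card (Lext A u w)) + 1"

definition ordinary :: "'a set \<Rightarrow> 'a word \<Rightarrow> 'a list \<Rightarrow> bool" where
  "ordinary A u w \<longleftrightarrow> bispecial A u w \<and> bilateral_order A u w = 0"

end

theory Submission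
  imports Defs
begin

text \<open>Write \<open>P n\<close> for the number of palindromic factors of length \<open>n\<close>. Identify each factor of
  length \<open>n\<close> with its reversal: the word \<open>u\<close> is a walk through the resulting quotient of the
  Rauzy graph, so that graph is connected, and palindromic edges become loops. Comparing the numbers
  of vertices and of non-loop edges gives \<open>P n + P (n + 1) \<le> C (n + 1) - C n + 2 = k + 1\<close>, and in
  the case of equality the quotient is a tree apart from its loops.

  Unique palindromic extensions force equality for every \<open>n\<close>; the left and right extensions of a
  factor \<open>w\<close> then span a forest in the tree of order \<open>length w + 1\<close>, which means \<open>b(w) \<le> 0\<close>. As the
  sum of \<open>b(w)\<close> over all factors of a given length is the second difference of the complexity,
  i.e. zero, all bilateral orders vanish. Conversely, reversal acts on the bilateral extensions of
  a palindrome, so \<open>b(w) = 0\<close> makes the number of its palindromic extensions odd, hence positive.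
  Thus \<open>P (n + 2) \<ge> P n\<close>, the upper bound is attained for every \<open>n\<close>, and uniqueness follows.\<close>

section \<open>First visits of a walk\<close>

text \<open>Here \<open>t x\<close> is the time of the first visit to \<open>x\<close> and
  \<open>p x\<close> the edge by which \<open>x\<close> is then entered. If two distinct vertices
  shared this edge, each would be entered from the other, so each would be visited before the
  other.\<close>

lemma walk_first_visits:
  fixes v :: "nat \<Rightarrow> 'v" and e :: "nat \<Rightarrow> 'e"
  assumes ends: "\<And>i j. e i = e j \<Longrightarrow> {v i, v (Suc i)} = {v j, v (Suc j)}"
  obtains p :: "'v \<Rightarrow> 'e" and t :: "'v \<Rightarrow> nat" where
    "inj_on p (range v - {v 0})"
    "\<And>x. x \<in> range v - {v 0} \<Longrightarrow> \<exists>i. p x = e i \<and> v (Suc i) = x \<and> t (v i) < t x"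
proof -
  define t where "t x = (LEAST i. v i = x)" for x
  have vt: "v (t x) = x" if "x \<in> range v" for x
    using that unfolding t_def by (metis (mono_tags, lifting) LeastI_ex imageE)
  have t_le: "t (v i) \<le> i" for i
    unfolding t_def by (simp add: Least_le)
  define p where "p x = e (t x - 1)" for x
  \<comment> \<open>Since \<open>x\<close> is not the start \<open>v 0\<close>, its first visit has
    positive time, so the truncated subtraction is exact.\<close>
  have Suc_t: "Suc (t x - 1) = t x" if "x \<in> range v - {v 0}" for x
    using vt[of x] that by (cases "t x") auto
  have step: "v (Suc (t x - 1)) = x" "t (v (t x - 1)) < t x" if "x \<in> range v - {v 0}" for x
    using Suc_t[OF that] vt[of x] t_le[of "t x - 1"] that by auto
  have "inj_on p (range v - {v 0})"
  proof (rule inj_onI)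
    fix x y assume x: "x \<in> range v - {v 0}" and y: "y \<in> range v - {v 0}" and "p x = p y"
    then have "{v (t x - 1), x} = {v (t y - 1), y}"
      using ends[of "t x - 1" "t y - 1"] step(1)[OF x] step(1)[OF y] by (simp add: p_def)
    then have "x = y \<or> v (t x - 1) = y \<and> x = v (t y - 1)"
      unfolding doubleton_eq_iff by blast
    then show "x = y"
      using step(2)[OF x] step(2)[OF y] order_less_asym by metis
  qed
  moreover have "\<exists>i. p x = e i \<and> v (Suc i) = x \<and> t (v i) < t x" if "x \<in> range v - {v 0}" for x
    using step[OF that] by (auto simp: p_def)
  ultimately show thesis by (rule that)
qed

text \<open>The first-entry edges inject the vertices other than the start into \<open>M\<close>:
  such an edge leads to a vertex with a strictly later first visit, so it is not a loop.\<close>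

lemma card_walk_le:
  fixes v :: "nat \<Rightarrow> 'v" and e :: "nat \<Rightarrow> 'e"
  assumes ends: "\<And>i j. e i = e j \<Longrightarrow> {v i, v (Suc i)} = {v j, v (Suc j)}"
    and "finite (range v)" and "finite M"
    and nonloop: "\<And>i. v i \<noteq> v (Suc i) \<Longrightarrow> e i \<in> M"
  shows "card (range v) \<le> Suc (card M)"
proof -
  obtain p t where p: "inj_on p (range v - {v 0})"
    "\<And>x. x \<in> range v - {v 0} \<Longrightarrow> \<exists>i. p x = e i \<and> v (Suc i) = x \<and> t (v i) < (t x :: nat)"
    using walk_first_visits[of e v, OF ends] by blast
  have "p ` (range v - {v 0}) \<subseteq> M"
  proof (rule image_subsetI)
    fix x assume "x \<in> range v - {v 0}"
    then obtain i where i: "p x = e i" "v (Suc i) = x" "t (v i) < t x"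
      using p(2) by blast
    then have "v i \<noteq> v (Suc i)" by auto
    then show "p x \<in> M"
      unfolding i(1) by (rule nonloop)
  qed
  then have "card (range v - {v 0}) \<le> card M"
    using p(1) \<open>finite M\<close> by (metis card_inj_on_le)
  then show ?thesis
    using \<open>finite (range v)\<close> by (simp add: card_Diff_singleton)
qed

text \<open>In the case of equality the edges of \<open>M\<close> form a tree: orienting each edge towards the
  vertex first visited through it, the vertex of \<open>X\<close> visited first receives no edge of \<open>F\<close>.\<close>

lemma card_subforest_less:
  fixes v :: "nat \<Rightarrow> 'v" and e :: "nat \<Rightarrow> 'e"
  assumes ends: "\<And>i j. e i = e j \<Longrightarrow> {v i, v (Suc i)} = {v j, v (Suc j)}"
    and fin: "finite (range v)" "finite M"
    and nonloop: "\<And>i. v i \<noteq> v (Suc i) \<Longrightarrow> e i \<in> M"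
    and tree: "card (range v) = Suc (card M)"
    and X: "X \<subseteq> range v" "X \<noteq> {}" and F: "F \<subseteq> M"
    and inner: "\<And>i. e i \<in> F \<Longrightarrow> v i \<in> X \<and> v (Suc i) \<in> X"
  shows "card F < card X"
proof -
  obtain p t where p: "inj_on p (range v - {v 0})"
    "\<And>x. x \<in> range v - {v 0} \<Longrightarrow> \<exists>i. p x = e i \<and> v (Suc i) = x \<and> t (v i) < (t x :: nat)"
    using walk_first_visits[of e v, OF ends] by blast
  have "p ` (range v - {v 0}) \<subseteq> M"
  proof (rule image_subsetI)
    fix x assume "x \<in> range v - {v 0}"
    then obtain i where i: "p x = e i" "v (Suc i) = x" "t (v i) < t x"
      using p(2) by blast
    then have "v i \<noteq> v (Suc i)" by auto
    then show "p x \<in> M"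
      unfolding i(1) by (rule nonloop)
  qed
  \<comment> \<open>By \<open>tree\<close> the injection is onto: every edge of \<open>M\<close> is
    the first-entry edge of some vertex.\<close>
  moreover have "card (p ` (range v - {v 0})) = card M"
    using p(1) tree fin by (simp add: card_image)
  ultimately have M: "p ` (range v - {v 0}) = M"
    using fin by (simp add: card_subset_eq)
  have finX: "finite X"
    using X(1) fin(1) finite_subset by blast
  obtain x0 where x0: "x0 \<in> X" "\<And>x. x \<in> X \<Longrightarrow> t x0 \<le> t x"
    using arg_min_if_finite(1)[OF finX X(2), of t] arg_min_least[OF finX X(2), of _ t] by blast
  have "F \<subseteq> p ` (X - {x0})"
  proof
    fix f assume f: "f \<in> F"
    then obtain x where x: "x \<in> range v - {v 0}" "f = p x"
      using F M by blast
    then obtain i where i: "p x = e i" "v (Suc i) = x" "t (v i) < t x"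
      using p(2) by blast
    then have "v i \<in> X" "x \<in> X"
      using inner[of i] f x by auto
    then show "f \<in> p ` (X - {x0})"
      using x0(2)[of "v i"] i(3) x(2) by auto
  qed
  then have "card F \<le> card (p ` (X - {x0}))"
    using finX by (intro card_mono) auto
  also have "\<dots> \<le> card (X - {x0})"
    using finX by (intro card_image_le) auto
  also have "\<dots> < card X"
    using finX x0(1) by (rule card_Diff1_less)
  finally show ?thesis .
qed

section \<open>Words up to reversal\<close>

definition rev_class :: "'a list \<Rightarrow> 'a list set" where
  "rev_class w = {w, rev w}"

lemma rev_class_eq_iff: "rev_class x = rev_class y \<longleftrightarrow> x = y \<or> x = rev y"
  by (auto simp: rev_class_def doubleton_eq_iff)

lemma mem_rev_class_iff: "x \<in> rev_class y \<longleftrightarrow> rev_class x = rev_class y"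
  by (auto simp: rev_class_def doubleton_eq_iff)

lemma rev_class_rev [simp]: "rev_class (rev w) = rev_class w"
  by (auto simp: rev_class_def)

lemma palindrome_iff: "palindrome w \<longleftrightarrow> rev w = w"
  by (auto simp: palindrome_def)

lemma palindrome_rev [simp]: "palindrome (rev w) \<longleftrightarrow> palindrome w"
  by (auto simp: palindrome_iff)

text \<open>The classes partition the non-palindromes of \<open>S\<close> into pairs.\<close>

lemma card_nonpalindrome_classes:
  assumes "finite S" and "rev ` S \<subseteq> S"
  shows "2 * card (rev_class ` {w \<in> S. \<not> palindrome w}) = card {w \<in> S. \<not> palindrome w}"
proof -
  let ?Q = "{w \<in> S. \<not> palindrome w}"
  have un: "\<Union> (rev_class ` ?Q) = ?Q"
    using assms(2) by (auto simp: rev_class_def)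
  have "2 * card (rev_class ` ?Q) = card (\<Union> (rev_class ` ?Q))"
  proof (rule card_partition)
    show "finite (\<Union> (rev_class ` ?Q))"
      unfolding un using assms(1) by simp
    show "\<And>c. c \<in> rev_class ` ?Q \<Longrightarrow> card c = 2"
      by (auto simp: rev_class_def palindrome_iff card_insert_if)
  qed (use assms(1) in \<open>auto simp: mem_rev_class_iff\<close>)
  then show ?thesis
    by (simp only: un)
qed

text \<open>Palindromes form singleton classes and the other words form pairs, so doubling the
  number of classes counts each palindrome twice and every other word once.\<close>

lemma card_rev_classes:
  assumes "finite S" and "rev ` S \<subseteq> S"
  shows "2 * card (rev_class ` S) = card S + card {w \<in> S. palindrome w}"
proof -
  let ?P = "{w \<in> S. palindrome w}" and ?Q = "{w \<in> S. \<not> palindrome w}"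
  have S: "S = ?P \<union> ?Q" by auto
  have fin: "finite ?P" "finite ?Q" using assms(1) by auto
  have "card S = card ?P + card ?Q"
    using fin by (subst S, intro card_Un_disjoint) auto
  moreover have "card (rev_class ` S) = card (rev_class ` ?P) + card (rev_class ` ?Q)"
    using fin by (subst S, subst image_Un, intro card_Un_disjoint)
      (auto simp: rev_class_eq_iff palindrome_iff)
  moreover have "card (rev_class ` ?P) = card ?P"
    by (intro card_image inj_onI) (auto simp: rev_class_eq_iff palindrome_iff)
  ultimately show ?thesis
    using card_nonpalindrome_classes[OF assms] by simp
qed

lemma tl_rev: "tl (rev xs) = rev (butlast xs)"
  by (cases xs rule: rev_cases) auto

lemma butlast_rev: "butlast (rev xs) = rev (tl xs)"
  by (cases xs) auto

lemma length_Suc_SucE: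
  assumes "length x = Suc (Suc n)"
  obtains a w b where "x = a # w @ [b]"
  using assms by (metis length_Suc_conv length_Suc_conv_rev)

section \<open>Factors and their extensions\<close>

definition factors :: "'a word \<Rightarrow> nat \<Rightarrow> 'a list set" where
  "factors u n = {w \<in> language u. length w = n}"

text \<open>Indexing factors by their starting position is what later makes the word a walk, with
  the position as time.\<close>

lemma factors_eq_range: "factors u n = range (\<lambda>i. map u [i..<i + n])"
proof (intro set_eqI iffI)
  fix w assume "w \<in> factors u n"
  then obtain i j where "i \<le> j" "w = map u [i..<j]" "j - i = n"
    by (auto simp: factors_def language_def subsequence_def)
  then show "w \<in> range (\<lambda>i. map u [i..<i + n])"
    by (intro image_eqI[of _ _ i]) auto
next
  fix w assume "w \<in> range (\<lambda>i. map u [i..<i + n])"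
  then obtain i where "w = map u [i..<i + n]" by blast
  then show "w \<in> factors u n"
    unfolding factors_def language_def subsequence_def
    by (force intro: exI[of _ i] exI[of _ "i + n"])
qed

lemma language_infix:
  assumes "x @ y @ z \<in> language u"
  shows "y \<in> language u"
proof -
  obtain i j where ij: "i \<le> j" "x @ y @ z = map u [i..<j]"
    using assms by (auto simp: language_def subsequence_def)
  then have len: "length x + length y + length z = j - i"
    by (metis length_append length_map length_upt add.assoc)
  have "y = take (length y) (drop (length x) (x @ y @ z))" by simp
  also have "\<dots> = map u [i + length x..<i + length x + length y]"
    using ij len by (simp add: drop_map take_map)
  finally have "y \<in> factors u (length y)"
    unfolding factors_eq_range by blast
  then show ?thesis by (simp add: factors_def)
qed

lemma language_butlast_tl:
  assumes "w \<in> language u"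
  shows "butlast w \<in> language u" and "tl w \<in> language u"
proof -
  show "butlast w \<in> language u"
    using assms language_infix[of "[]" "butlast w" "[last w]" u]
    by (cases w rule: rev_cases) auto
  show "tl w \<in> language u"
    using assms language_infix[of "[hd w]" "tl w" "[]" u] by (cases w) auto
qed

lemma set_language: "w \<in> language u \<Longrightarrow> set w \<subseteq> range u"
  by (auto simp: language_def)

lemma language_right_extendable:
  assumes "w \<in> language u"
  shows "\<exists>a. w @ [a] \<in> language u"
proof -
  obtain i where "w = map u [i..<i + length w]"
    using assms factors_eq_range[of u "length w"] by (auto simp: factors_def)
  then have "w @ [u (i + length w)] = map u [i..<i + Suc (length w)]"
    by simp
  then have "w @ [u (i + length w)] \<in> factors u (Suc (length w))"
    unfolding factors_eq_range by (rule range_eqI)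
  then show ?thesis by (auto simp: factors_def)
qed

lemma Lext_eq: "Lext (range u) u w = {a. a # w \<in> language u}"
  using set_language by (fastforce simp: Lext_def)

lemma Rext_eq: "Rext (range u) u w = {a. w @ [a] \<in> language u}"
  using set_language by (fastforce simp: Rext_def)

lemma Bext_eq: "Bext (range u) u w = {a # w @ [b] | a b. a # w @ [b] \<in> language u}"
  using set_language by (fastforce simp: Bext_def)

lemma palindromic_extension_iff:
  "palindromic_extension (range u) u w v \<longleftrightarrow> v \<in> language u \<and> (\<exists>a. v = a # w @ [a])"
  using set_language by (fastforce simp: palindromic_extension_def)

lemma palindrome_sandwich [simp]: "palindrome (a # w @ [b]) \<longleftrightarrow> a = b \<and> palindrome w"
  by (auto simp: palindrome_iff)

definition palindromes :: "'a word \<Rightarrow> nat \<Rightarrow> 'a list set" where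
  "palindromes u n = {w \<in> factors u n. palindrome w}"

section \<open>Words whose language is closed under reversal\<close>

locale reversal_closed_word =
  fixes u :: "'a word"
  assumes finite_letters: "finite (range u)"
    and closed: "closed_under_reversal u"
begin

lemma rev_in_language [simp]: "rev w \<in> language u \<longleftrightarrow> w \<in> language u"
  using closed by (metis closed_under_reversal_def rev_rev_ident)

lemma finite_factors [simp]: "finite (factors u n)"
  by (rule finite_subset[OF _ finite_lists_length_eq[OF finite_letters, of n]])
    (auto simp: factors_def dest!: set_language)

lemma rev_factors: "rev ` factors u n \<subseteq> factors u n"
  by (auto simp: factors_def)

lemma finite_palindromes [simp]: "finite (palindromes u n)"
  by (simp add: palindromes_def)

text \<open>A prefix of a one-sided word may have no letter before it; closure under reversal
  supplies one by extending \<open>rev w\<close> to the right.\<close>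

lemma language_left_extendable:
  assumes "w \<in> language u"
  shows "\<exists>a. a # w \<in> language u"
proof -
  obtain a where "rev w @ [a] \<in> language u"
    using assms language_right_extendable[of "rev w" u] by auto
  then have "rev (rev w @ [a]) \<in> language u"
    by (simp only: rev_in_language)
  then show ?thesis by auto
qed

lemma finite_ext:
  shows finite_Lext: "finite (Lext (range u) u w)"
    and finite_Rext: "finite (Rext (range u) u w)"
    and finite_Bext: "finite (Bext (range u) u w)"
proof -
  show "finite (Lext (range u) u w)" "finite (Rext (range u) u w)"
    using finite_letters by (simp_all add: Lext_def Rext_def)
  have "Bext (range u) u w \<subseteq> factors u (Suc (Suc (length w)))"
    by (auto simp: Bext_eq factors_def)
  then show "finite (Bext (range u) u w)"
    by (rule finite_subset) simp
qed

text \<open>A factor of length \<open>n + 1\<close> is determined by its prefix of length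
  \<open>n\<close> and its last letter. This sum and the next two combine into the second difference
  in \<open>sum_bilateral_order\<close>.\<close>

lemma sum_card_Rext: "(\<Sum>w\<in>factors u n. card (Rext (range u) u w)) = card (factors u (Suc n))"
proof -
  have "factors u (Suc n) = (\<lambda>(w, a). w @ [a]) ` (SIGMA w:factors u n. Rext (range u) u w)"
  proof (intro set_eqI iffI)
    fix x assume "x \<in> factors u (Suc n)"
    then show "x \<in> (\<lambda>(w, a). w @ [a]) ` (SIGMA w:factors u n. Rext (range u) u w)"
      using language_butlast_tl(1)[of x u]
      by (cases x rule: rev_cases) (auto simp: factors_def Rext_eq image_iff)
  qed (auto simp: factors_def Rext_eq)
  then show ?thesis
    by (simp add: card_image inj_on_def finite_Rext)
qed

lemma sum_card_Lext: "(\<Sum>w\<in>factors u n. card (Lext (range u) u w)) = card (factors u (Suc n))"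
proof -
  have "factors u (Suc n) = (\<lambda>(w, a). a # w) ` (SIGMA w:factors u n. Lext (range u) u w)"
  proof (intro set_eqI iffI)
    fix x assume "x \<in> factors u (Suc n)"
    then show "x \<in> (\<lambda>(w, a). a # w) ` (SIGMA w:factors u n. Lext (range u) u w)"
      using language_butlast_tl(2)[of x u]
      by (cases x) (auto simp: factors_def Lext_eq image_iff)
  qed (auto simp: factors_def Lext_eq)
  then show ?thesis
    by (simp add: card_image inj_on_def finite_Lext)
qed

lemma sum_card_Bext:
  "(\<Sum>w\<in>factors u n. card (Bext (range u) u w)) = card (factors u (Suc (Suc n)))"
proof -
  have "factors u (Suc (Suc n)) = snd ` (SIGMA w:factors u n. Bext (range u) u w)"
  proof (intro set_eqI iffI)
    fix x assume x: "x \<in> factors u (Suc (Suc n))"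
    then obtain a w b where [simp]: "x = a # w @ [b]"
      by (auto simp: factors_def elim: length_Suc_SucE)
    have "w \<in> factors u n"
      using x language_infix[of "[a]" w "[b]" u] by (auto simp: factors_def)
    with x show "x \<in> snd ` (SIGMA w:factors u n. Bext (range u) u w)"
      by (auto simp: factors_def Bext_eq image_iff)
  qed (auto simp: factors_def Bext_eq)
  moreover have "inj_on snd (SIGMA w:factors u n. Bext (range u) u w)"
    by (auto simp: inj_on_def Bext_eq)
  ultimately show ?thesis
    by (simp add: card_image finite_Bext)
qed

lemma sum_bilateral_order:
  "(\<Sum>w\<in>factors u n. bilateral_order (range u) u w)
    = int (card (factors u (Suc (Suc n)))) - 2 * int (card (factors u (Suc n)))
      + int (card (factors u n))"
  unfolding bilateral_order_def sum.distrib sum_subtractf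
  by (simp add: sum_card_Lext sum_card_Rext sum_card_Bext flip: of_nat_sum)

lemma Rext_palindrome: "palindrome w \<Longrightarrow> Rext (range u) u w = Lext (range u) u w"
  using rev_in_language[of "a # w" for a]
  by (auto simp: Lext_eq Rext_eq palindrome_iff simp del: rev_in_language)

lemma rev_Bext: "palindrome w \<Longrightarrow> rev ` Bext (range u) u w \<subseteq> Bext (range u) u w"
proof (rule image_subsetI)
  fix x assume w: "palindrome w" and "x \<in> Bext (range u) u w"
  then obtain a b where x: "x = a # w @ [b]" "x \<in> language u"
    by (auto simp: Bext_eq)
  then have "rev x = b # w @ [a]"
    using w by (simp add: palindrome_iff)
  moreover have "rev x \<in> language u"
    using x(2) by simp
  ultimately show "rev x \<in> Bext (range u) u w"
    unfolding Bext_eq by auto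
qed

section \<open>The Rauzy graph modulo reversal\<close>

text \<open>Read as a walk, \<open>factor_class n i\<close> is the vertex at time \<open>i\<close>,
  and \<open>factor_class (Suc n) i\<close> is the edge traversed between times \<open>i\<close> and
  \<open>i + 1\<close>.\<close>

definition factor_class :: "nat \<Rightarrow> nat \<Rightarrow> 'a list set" where
  "factor_class n i = rev_class (map u [i..<i + n])"

lemma range_factor_class: "range (factor_class n) = rev_class ` factors u n"
  by (auto simp: factor_class_def factors_eq_range)

lemma factor_class_ends:
  shows factor_class_butlast: "factor_class n i = rev_class (butlast (map u [i..<i + Suc n]))"
    and factor_class_tl: "factor_class n (Suc i) = rev_class (tl (map u [i..<i + Suc n]))"
  by (simp add: factor_class_def, simp add: factor_class_def tl_upt flip: map_tl del: upt_Suc)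

text \<open>Reversing an edge word swaps its two ends up to reversal, so the unordered pair of ends
  depends only on the class.\<close>

lemma factor_class_edge:
  assumes "factor_class (Suc n) i = rev_class x"
  shows "{factor_class n i, factor_class n (Suc i)} = {rev_class (butlast x), rev_class (tl x)}"
proof -
  consider "map u [i..<i + Suc n] = x" | "map u [i..<i + Suc n] = rev x"
    using assms unfolding factor_class_def rev_class_eq_iff by blast
  then show ?thesis
  proof cases
    case 1
    then show ?thesis
      unfolding factor_class_butlast[of n i] factor_class_tl[of n i] by simp
  next
    case 2
    then show ?thesis
      unfolding factor_class_butlast[of n i] factor_class_tl[of n i]
      by (simp add: butlast_rev tl_rev insert_commute del: upt_Suc)
  qed
qed

lemma factor_class_edge_cong:
  assumes "factor_class (Suc n) i = factor_class (Suc n) j"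
  shows "{factor_class n i, factor_class n (Suc i)} = {factor_class n j, factor_class n (Suc j)}"
  using factor_class_edge[of n i "map u [j..<j + Suc n]"]
    factor_class_edge[of n j "map u [j..<j + Suc n]"] assms
  by (simp add: factor_class_def del: upt_Suc)

text \<open>In a palindrome the prefix obtained by deleting the last letter is the reversal of the
  suffix obtained by deleting the first, so palindromic edges are loops.\<close>

lemma factor_class_nonloop:
  assumes "factor_class n i \<noteq> factor_class n (Suc i)"
  shows "factor_class (Suc n) i \<in> rev_class ` {w \<in> factors u (Suc n). \<not> palindrome w}"
proof -
  let ?w = "map u [i..<i + Suc n]"
  have "\<not> palindrome ?w"
  proof
    assume "palindrome ?w"
    then have "butlast ?w = rev (tl ?w)"
      unfolding palindrome_iff by (metis butlast_rev)
    then show False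
      using assms rev_class_rev unfolding factor_class_butlast[of n i] factor_class_tl[of n i]
      by metis
  qed
  moreover have "?w \<in> factors u (Suc n)"
    unfolding factors_eq_range by blast
  ultimately show ?thesis
    unfolding factor_class_def by blast
qed

lemma card_factor_classes:
  "2 * card (rev_class ` factors u n) = card (factors u n) + card (palindromes u n)"
  using card_rev_classes[OF finite_factors rev_factors] by (simp add: palindromes_def)

lemma card_nonpalindromic_factor_classes:
  "2 * card (rev_class ` {w \<in> factors u n. \<not> palindrome w}) + card (palindromes u n)
    = card (factors u n)"
proof -
  have "factors u n = {w \<in> factors u n. \<not> palindrome w} \<union> palindromes u n"
    by (auto simp: palindromes_def)
  then have "card (factors u n) = card {w \<in> factors u n. \<not> palindrome w} + card (palindromes u n)"
    by (subst (1) \<open>factors u n = _\<close>, intro card_Un_disjoint) (auto simp: palindromes_def)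
  then show ?thesis
    using card_nonpalindrome_classes[OF finite_factors rev_factors, of n] by simp
qed

lemma card_palindromes_le:
  "card (palindromes u n) + card (palindromes u (Suc n)) + card (factors u n)
    \<le> card (factors u (Suc n)) + 2"
proof -
  have "card (rev_class ` factors u n)
      \<le> Suc (card (rev_class ` {w \<in> factors u (Suc n). \<not> palindrome w}))"
    using card_walk_le[of "factor_class (Suc n)" "factor_class n",
        OF factor_class_edge_cong _ _ factor_class_nonloop]
    unfolding range_factor_class by simp
  then show ?thesis
    using card_factor_classes[of n] card_nonpalindromic_factor_classes[of "Suc n"] by linarith
qed

lemma card_classes_less:
  assumes rich: "card (palindromes u n) + card (palindromes u (Suc n)) + card (factors u n)
      = card (factors u (Suc n)) + 2"
    and Y: "Y \<subseteq> factors u n" "Y \<noteq> {}"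
    and B: "B \<subseteq> factors u (Suc n)"
    and inner: "\<And>x. x \<in> B \<Longrightarrow> \<not> palindrome x \<and> rev_class (butlast x) \<in> rev_class ` Y
      \<and> rev_class (tl x) \<in> rev_class ` Y"
  shows "card (rev_class ` B) < card (rev_class ` Y)"
proof (rule card_subforest_less[of "factor_class (Suc n)" "factor_class n",
      OF factor_class_edge_cong _ _ factor_class_nonloop])
  show "finite (range (factor_class n))"
    unfolding range_factor_class by simp
  \<comment> \<open>Halving the class counts turns \<open>rich\<close> into: one more vertex than
    non-palindromic edges.\<close>
  show "card (range (factor_class n))
      = Suc (card (rev_class ` {w \<in> factors u (Suc n). \<not> palindrome w}))"
    using rich card_factor_classes[of n] card_nonpalindromic_factor_classes[of "Suc n"]
    unfolding range_factor_class by linarith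
  show "rev_class ` Y \<subseteq> range (factor_class n)"
    unfolding range_factor_class using Y(1) by blast
  show "rev_class ` Y \<noteq> {}" using Y(2) by simp
  show "rev_class ` B \<subseteq> rev_class ` {w \<in> factors u (Suc n). \<not> palindrome w}"
    using B inner by blast
  show "factor_class n i \<in> rev_class ` Y \<and> factor_class n (Suc i) \<in> rev_class ` Y"
    if i: "factor_class (Suc n) i \<in> rev_class ` B" for i
  proof -
    obtain x where "x \<in> B" "factor_class (Suc n) i = rev_class x"
      using i by blast
    then show ?thesis
      using factor_class_edge[of n i x] inner[of x] by (auto simp: doubleton_eq_iff)
  qed
qed simp_all

section \<open>Palindromic extensions and bilateral orders\<close>

text \<open>A word \<open>a w b\<close> is an edge between the classes of \<open>a w\<close> and
  \<open>w b\<close> in the graph of order \<open>n + 1\<close>, which is a tree up to loops by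
  \<open>rich\<close>. Hence the non-palindromic bilateral extensions have fewer classes than the
  one-sided extensions. For a palindrome \<open>w\<close>, left and right extensions share classes,
  and its single palindromic extension, a loop, is counted separately.\<close>

lemma bilateral_order_nonpos:
  assumes rich: "card (palindromes u (Suc n)) + card (palindromes u (Suc (Suc n)))
      + card (factors u (Suc n)) = card (factors u (Suc (Suc n))) + 2"
    and w: "w \<in> factors u n"
    and ext: "palindrome w \<Longrightarrow> \<exists>!v. palindromic_extension (range u) u w v"
  shows "bilateral_order (range u) u w \<le> 0"
proof -
  let ?L = "Lext (range u) u w" and ?R = "Rext (range u) u w" and ?B = "Bext (range u) u w"
  have len: "length w = n" and wL: "w \<in> language u"
    using w by (auto simp: factors_def)
  obtain a0 where a0: "a0 # w \<in> language u"
    using language_left_extendable[OF wL] by blast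
  have B_sub: "?B \<subseteq> factors u (Suc (Suc n))"
    by (auto simp: Bext_eq factors_def len)
  have ends: "a \<in> ?L" "b \<in> ?R" if "a # w @ [b] \<in> language u" for a b
    using language_infix[of "[]" "a # w" "[b]" u] language_infix[of "[a]" "w @ [b]" "[]" u] that
    by (auto simp: Lext_eq Rext_eq)
  show ?thesis
  proof (cases "palindrome w")
    case False
    let ?Y = "(\<lambda>a. a # w) ` ?L \<union> (\<lambda>b. w @ [b]) ` ?R"
    have "card (rev_class ` ?B) < card (rev_class ` ?Y)"
    proof (rule card_classes_less[OF rich])
      show "?Y \<subseteq> factors u (Suc n)"
        by (auto simp: Lext_eq Rext_eq factors_def len)
      show "?Y \<noteq> {}" using a0 by (auto simp: Lext_eq)
      fix x assume "x \<in> ?B"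
      then obtain a b where x: "x = a # w @ [b]" "x \<in> language u"
        by (auto simp: Bext_eq)
      then show "\<not> palindrome x \<and> rev_class (butlast x) \<in> rev_class ` ?Y
          \<and> rev_class (tl x) \<in> rev_class ` ?Y"
        using False ends[of a b] by (auto simp: butlast_append)
    qed (rule B_sub)
    also have "\<dots> \<le> card ?Y"
      by (intro card_image_le) (simp add: finite_Lext finite_Rext)
    also have "\<dots> \<le> card ((\<lambda>a. a # w) ` ?L) + card ((\<lambda>b. w @ [b]) ` ?R)"
      by (rule card_Un_le)
    also have "\<dots> \<le> card ?L + card ?R"
      by (intro add_mono card_image_le finite_Lext finite_Rext)
    \<comment> \<open>Two extensions of \<open>w\<close> that are reversals of each other would have
      middles \<open>w\<close> and \<open>rev w\<close>, forcing \<open>w\<close> to be a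
      palindrome.\<close>
    also have "card (rev_class ` ?B) = card ?B"
      using False by (intro card_image inj_onI)
        (auto simp: Bext_eq rev_class_eq_iff palindrome_iff)
    finally show ?thesis
      by (simp add: bilateral_order_def)
  next
    case True
    let ?Y = "(\<lambda>a. a # w) ` ?L" and ?Q = "{x \<in> ?B. \<not> palindrome x}"
    have swap: "w @ [b] = rev (b # w)" for b
      using True by (simp add: palindrome_iff)
    have LR: "?R = ?L" by (rule Rext_palindrome[OF True])
    have "card (rev_class ` ?Q) < card (rev_class ` ?Y)"
    proof (rule card_classes_less[OF rich])
      show "?Y \<subseteq> factors u (Suc n)"
        by (auto simp: Lext_eq factors_def len)
      show "?Y \<noteq> {}" using a0 by (auto simp: Lext_eq)
      show "?Q \<subseteq> factors u (Suc (Suc n))" using B_sub by blast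
      fix x assume "x \<in> ?Q"
      then obtain a b where x: "x = a # w @ [b]" "x \<in> language u" "\<not> palindrome x"
        by (auto simp: Bext_eq)
      have "rev_class (w @ [b]) \<in> rev_class ` ?Y"
        using ends[of a b] x LR unfolding swap rev_class_rev by blast
      then show "\<not> palindrome x \<and> rev_class (butlast x) \<in> rev_class ` ?Y
          \<and> rev_class (tl x) \<in> rev_class ` ?Y"
        using x ends[of a b] by (auto simp: butlast_append)
    qed
    also have "\<dots> \<le> card ?Y"
      by (intro card_image_le) (simp add: finite_Lext)
    also have "\<dots> \<le> card ?L"
      by (intro card_image_le finite_Lext)
    finally have less: "card (rev_class ` ?Q) < card ?L" .
    obtain v where v: "\<And>x. palindromic_extension (range u) u w x \<longleftrightarrow> x = v"
      using ext[OF True] by auto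
    have "{x \<in> ?B. palindrome x} = {x. palindromic_extension (range u) u w x}"
      unfolding Bext_eq palindromic_extension_iff using True by auto
    then have "card {x \<in> ?B. palindrome x} = 1"
      by (simp add: v)
    moreover have B: "?Q \<union> {x \<in> ?B. palindrome x} = ?B" by auto
    have "card ?B \<le> card ?Q + card {x \<in> ?B. palindrome x}"
      using card_Un_le[of ?Q "{x \<in> ?B. palindrome x}"] unfolding B .
    ultimately have "card ?B \<le> card ?Q + 1" by simp
    then have "card ?B \<le> 2 * card (rev_class ` ?Q) + 1"
      using card_nonpalindrome_classes[OF finite_Bext rev_Bext[OF True]] by simp
    \<comment> \<open>With \<open>l = card ?L\<close>, there are at most
      \<open>2 * (l - 1) + 1 = l + l - 1\<close> bilateral extensions.\<close>
    with less show ?thesis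
      unfolding bilateral_order_def LR by linarith
  qed
qed

lemma ordinary_imp_palindromic_extension:
  assumes ord: "\<And>x. bispecial (range u) u x \<Longrightarrow> ordinary (range u) u x"
    and w: "w \<in> language u" "palindrome w"
  shows "\<exists>a. a # w @ [a] \<in> language u"
proof -
  let ?L = "Lext (range u) u w" and ?B = "Bext (range u) u w"
  have LR: "Rext (range u) u w = ?L" by (rule Rext_palindrome[OF w(2)])
  show ?thesis
  proof (cases "card ?L \<ge> 2")
    case True
    then have "bilateral_order (range u) u w = 0"
      using ord[of w] w LR by (auto simp: ordinary_def bispecial_def)
    \<comment> \<open>Left and right extensions are equinumerous, so order zero means
      \<open>card ?B = 2 * card ?L - 1\<close>. Reversal pairs off the non-palindromes of
      \<open>?B\<close>, leaving an odd number of palindromes.\<close>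
    then have "odd (int (card ?B))"
      unfolding bilateral_order_def LR by presburger
    then have "odd (card {x \<in> ?B. palindrome x})"
      using card_rev_classes[OF finite_Bext rev_Bext[OF w(2)]]
      by (metis dvd_triv_left even_add even_of_nat_iff)
    then have "{x \<in> ?B. palindrome x} \<noteq> {}"
      by (metis card.empty even_zero)
    then show ?thesis
      by (auto simp: Bext_eq)
  next
    case False
    \<comment> \<open>Extending \<open>w\<close> on both sides gives letters \<open>a\<close> and
      \<open>b\<close> that both lie in \<open>?L\<close>, which has at most one element.\<close>
    obtain b where b: "w @ [b] \<in> language u"
      using language_right_extendable[OF w(1)] by blast
    obtain a where a: "a # w @ [b] \<in> language u"
      using language_left_extendable[OF b] by auto
    have "b \<in> ?L" using b LR by (auto simp: Rext_eq)
    moreover have "a \<in> ?L"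
      using language_infix[of "[]" "a # w" "[b]" u] a by (auto simp: Lext_eq)
    moreover have "card ?L \<le> Suc 0"
      using False by simp
    ultimately have "a = b"
      using finite_Lext card_le_Suc0_iff_eq by metis
    then show ?thesis using a by blast
  qed
qed

section \<open>Stripping the outer letters of palindromes\<close>

lemma strip_palindromes:
  "(\<lambda>x. butlast (tl x)) ` palindromes u (Suc (Suc n)) \<subseteq> palindromes u n"
proof (rule image_subsetI)
  fix x assume x: "x \<in> palindromes u (Suc (Suc n))"
  then obtain a w b where [simp]: "x = a # w @ [b]"
    by (auto simp: palindromes_def factors_def elim: length_Suc_SucE)
  show "butlast (tl x) \<in> palindromes u n"
    using x language_infix[of "[a]" w "[b]" u] by (auto simp: palindromes_def factors_def)
qed

lemma palindromes_sandwich: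
  assumes "x \<in> palindromes u (Suc (Suc n))"
  obtains a where "x = a # butlast (tl x) @ [a]" "x \<in> language u"
proof -
  obtain a w b where [simp]: "x = a # w @ [b]"
    using assms by (auto simp: palindromes_def factors_def elim: length_Suc_SucE)
  show thesis
    using assms by (intro that[of a]) (auto simp: palindromes_def factors_def)
qed

text \<open>Existence of palindromic extensions is surjectivity of stripping; uniqueness corresponds
  to its injectivity.\<close>

lemma strip_palindromes_surj:
  assumes "\<And>w. w \<in> palindromes u n \<Longrightarrow> \<exists>a. a # w @ [a] \<in> language u"
  shows "(\<lambda>x. butlast (tl x)) ` palindromes u (Suc (Suc n)) = palindromes u n"
proof (rule equalityI[OF strip_palindromes subsetI])
  fix w assume w: "w \<in> palindromes u n"
  then obtain a where "a # w @ [a] \<in> language u" using assms by blast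
  with w show "w \<in> (\<lambda>x. butlast (tl x)) ` palindromes u (Suc (Suc n))"
    by (intro image_eqI[of _ _ "a # w @ [a]"]) (auto simp: palindromes_def factors_def)
qed

end

section \<open>The two directions of the equivalence\<close>

theorem theorem22:
  fixes A :: "'a set" and u :: "'a word" and k :: nat
  assumes "finite A"
    and "card A = k"
    and "range u = A"
    and "closed_under_reversal u"
    and "\<forall>n. complexity u n = (k - 1) * n + 1"
  shows "(\<forall>w \<in> language u. palindrome w \<longrightarrow> (\<exists>!v. palindromic_extension A u w v))
     \<longleftrightarrow> (\<forall>w. bispecial A u w \<longrightarrow> ordinary A u w)"
proof -
  interpret reversal_closed_word u
    using assms by unfold_locales auto
  have A: "A = range u" using assms by simp
  have "k > 0" using assms card_gt_0_iff by blast
  have C: "card (factors u n) = (k - 1) * n + 1" for n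
    using assms(5) by (simp add: complexity_def factors_def)
  have pal_le: "card (palindromes u n) + card (palindromes u (Suc n)) \<le> k + 1" for n
    using card_palindromes_le[of n] \<open>k > 0\<close> by (simp add: C)
  \<comment> \<open>The bound \<open>pal_le\<close> is attained at \<open>n = 0\<close>: the empty
    word and the \<open>k\<close> letters are all palindromes. This is the base of both inductions
    below.\<close>
  have "palindromes u 0 = {[]}"
    using C[of 0] by (auto simp: palindromes_def palindrome_iff factors_eq_range)
  moreover have "palindromes u (Suc 0) = factors u (Suc 0)"
    by (auto simp: palindromes_def palindrome_iff factors_eq_range)
  ultimately have pal_0: "card (palindromes u 0) + card (palindromes u (Suc 0)) = k + 1"
    using C[of "Suc 0"] \<open>k > 0\<close> by simp
  let ?strip = "\<lambda>x :: 'a list. butlast (tl x)"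
  show ?thesis
    unfolding A
  proof (intro iffI allI impI ballI)
    fix w
    assume ext: "\<forall>w \<in> language u. palindrome w \<longrightarrow> (\<exists>!v. palindromic_extension (range u) u w v)"
      and w: "bispecial (range u) u w"
    \<comment> \<open>Under unique extensions stripping is a bijection, so the sum of two
      consecutive palindrome counts never changes.\<close>
    have "card (palindromes u (Suc (Suc n))) = card (palindromes u n)" for n
    proof -
      have surj: "?strip ` palindromes u (Suc (Suc n)) = palindromes u n"
        using ext by (intro strip_palindromes_surj)
          (fastforce simp: palindromes_def factors_def palindromic_extension_iff)
      have "inj_on ?strip (palindromes u (Suc (Suc n)))"
      proof (rule inj_onI)
        fix x y assume x: "x \<in> palindromes u (Suc (Suc n))" and y: "y \<in> palindromes u (Suc (Suc n))"
          and eq: "?strip x = ?strip y"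
        have "palindromic_extension (range u) u (?strip x) x"
          "palindromic_extension (range u) u (?strip x) y"
          using palindromes_sandwich[OF x] palindromes_sandwich[OF y] eq
          unfolding palindromic_extension_iff by metis+
        moreover have "?strip x \<in> language u" "palindrome (?strip x)"
          using x surj by (auto simp: palindromes_def factors_def)
        ultimately show "x = y" using ext by blast
      qed
      then show ?thesis using surj card_image by metis
    qed
    then have rich: "card (palindromes u n) + card (palindromes u (Suc n)) = k + 1" for n
      by (induction n) (use pal_0 in auto)
    let ?n = "length w"
    have "bilateral_order (range u) u x \<le> 0" if "x \<in> factors u ?n" for x
    proof (rule bilateral_order_nonpos[OF _ that])
      show "card (palindromes u (Suc ?n)) + card (palindromes u (Suc (Suc ?n)))
          + card (factors u (Suc ?n)) = card (factors u (Suc (Suc ?n))) + 2"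
        using rich[of "Suc ?n"] \<open>k > 0\<close> by (simp add: C)
      show "\<exists>!v. palindromic_extension (range u) u x v" if "palindrome x"
        using ext that \<open>x \<in> factors u ?n\<close> by (simp add: factors_def)
    qed
    moreover have "(\<Sum>x\<in>factors u ?n. bilateral_order (range u) u x) = 0"
      unfolding sum_bilateral_order by (cases k) (simp_all add: C algebra_simps)
    moreover have "w \<in> factors u ?n"
      using w by (simp add: bispecial_def factors_def)
    \<comment> \<open>The terms are nonpositive with sum zero, so all vanish; the library fact on
      nonnegative sums is applied to their negatives.\<close>
    ultimately have "bilateral_order (range u) u w = 0"
      using sum_nonneg_eq_0_iff[of "factors u ?n" "\<lambda>x. - bilateral_order (range u) u x"]
      by (simp add: sum_negf)
    with w show "ordinary (range u) u w" by (simp add: ordinary_def)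
  next
    fix w
    assume ord: "\<forall>w. bispecial (range u) u w \<longrightarrow> ordinary (range u) u w"
      and w: "w \<in> language u" "palindrome w"
    have surj: "?strip ` palindromes u (Suc (Suc n)) = palindromes u n" for n
      using ord by (intro strip_palindromes_surj ordinary_imp_palindromic_extension)
        (auto simp: palindromes_def factors_def)
    have mono: "card (palindromes u n) \<le> card (palindromes u (Suc (Suc n)))" for n
      using card_image_le[of "palindromes u (Suc (Suc n))" ?strip] by (simp add: surj)
    \<comment> \<open>By \<open>mono\<close> the sum of consecutive counts cannot drop, and by
      \<open>pal_le\<close> it cannot exceed its initial value \<open>k + 1\<close>.\<close>
    have rich: "card (palindromes u n) + card (palindromes u (Suc n)) = k + 1" for n
    proof (induction n)
      case (Suc n)
      then show ?case using mono[of n] pal_le[of "Suc n"] by linarith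
    qed (rule pal_0)
    let ?P = "palindromes u (Suc (Suc (length w)))"
    \<comment> \<open>Two consecutive instances of \<open>rich\<close> give equal cardinalities, so
      the surjective stripping map is also injective.\<close>
    have "card ?P = card (palindromes u (length w))"
      using rich[of "length w"] rich[of "Suc (length w)"] by linarith
    then have inj: "inj_on ?strip ?P"
      by (intro eq_card_imp_inj_on) (simp_all add: surj)
    obtain a where a: "a # w @ [a] \<in> language u"
      using ordinary_imp_palindromic_extension ord w by blast
    show "\<exists>!v. palindromic_extension (range u) u w v"
    proof (rule ex1I)
      show "palindromic_extension (range u) u w (a # w @ [a])"
        using a by (auto simp: palindromic_extension_iff)
      fix v assume "palindromic_extension (range u) u w v"
      then obtain b where b: "v = b # w @ [b]" "v \<in> language u"
        by (auto simp: palindromic_extension_iff)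
      have "v \<in> ?P" "a # w @ [a] \<in> ?P" "?strip v = ?strip (a # w @ [a])"
        using a b w(2) by (auto simp: palindromes_def factors_def)
      then show "v = a # w @ [a]"
        using inj by (meson inj_onD)
    qed
  qed
qed

end
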